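(* Let $p$ be a prime power and $t$ a (positive) integer. Let $\rho_{X_0XE}$ be a ccq state with $X_0\in\mathbb{F}_p$ and $X=(X_1,\dots,X_t)\in\mathbb{F}_p^t$. For each $a=(a_1,\dots,a_t)\in\mathbb{F}_p^t$ define the random variable $Z=X_0+\langle a,X\rangle=X_0+\sum_{i=1}^t a_iX_i$, and let $\rho^a_{ZE}$ be the resulting joint cq state of $Z$ and $E$. Let $\varepsilon\ge0$ be such that for all $a\in\mathbb{F}_p^t$, $\frac12\|\rho^a_{ZE}-U_Z\otimes\rho_E\|_1\le\varepsilon$. Then $$\frac12\big\|\rho_{X_0XE}-U_{X_0}\otimes\rho_{XE}\big\|_1\le p^{\frac{t+1}2}\sqrt{\frac{\varepsilon}{2}} .$$
   Context: $\mathbb{F}_p$ is the finite field with $p$ elements. A ccq state is a density matrix $\rho_{X_0XE}=\sum_{x_0,x}|x_0\rangle\langle x_0|\otimes|x\rangle\langle x|\otimes\rho_E^{x_0x}$ on finite-dimensional spaces, with $\rho_E^{x_0x}\ge0$ and total trace $1$; here $x_0$ ranges over $\mathbb{F}_p$ and $x$ over $\mathbb{F}_p^t$. Omitting a register means taking the reduced state. Explicitly, $\rho^a_{ZE}=\sum_{z\in\mathbb{F}_p}|z\rangle\langle z|\otimes\sum_{(x_0,x):\,x_0+\langle a,x\rangle=z}\rho_E^{x_0x}$. $U_Z$ and $U_{X_0}$ denote the maximally mixed (uniform) state on the $p$-dimensional register indexed by $\mathbb{F}_p$. $\|\cdot\|_1$ is the trace norm. *)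

theory Defs
  imports "HOL-Analysis.Analysis"
begin

text \<open>
  A register with basis indexed by a finite type \<open>'n\<close> has operators \<open>complex^'n^'n\<close>, where
  \<open>A $ i $ j\<close> is the entry in row \<open>i\<close> and column \<open>j\<close>; composite registers are indexed by product
  types. The field of order \<open>p\<close> is a type \<open>'f :: {field, finite}\<close> with \<open>p = CARD('f)\<close>, and its
  \<open>t\<close>-fold power is \<open>'f^'t\<close> with \<open>t = CARD('t)\<close>. Since types are nonempty, \<open>t > 0\<close>.
\<close>

definition conj_transpose :: "complex^'n^'m \<Rightarrow> complex^'m^'n" where
  "conj_transpose A = (\<chi> i j. cnj (A $ j $ i))"

definition pos_semidef :: "complex^'n^'n \<Rightarrow> bool" where
  "pos_semidef A \<longleftrightarrow> conj_transpose A = A \<and>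
     (\<forall>v. 0 \<le> Re (\<Sum>i\<in>UNIV. cnj (v $ i) * (A *v v) $ i))"

text \<open>Meaningful for positive semidefinite arguments, which have a unique such root.\<close>

definition psd_sqrt :: "complex^'n^'n \<Rightarrow> complex^'n^'n" where
  "psd_sqrt A = (THE B. pos_semidef B \<and> B ** B = A)"

definition trace_norm :: "complex^'n^'n \<Rightarrow> real" where
  "trace_norm A = Re (trace (psd_sqrt (conj_transpose A ** A)))"

definition kron :: "complex^'a::finite^'a \<Rightarrow> complex^'b::finite^'b \<Rightarrow> complex^('a \<times> 'b)^('a \<times> 'b)" where
  "kron A B = (\<chi> i j. A $ fst i $ fst j * B $ snd i $ snd j)"

definition basis_proj :: "'n::finite \<Rightarrow> complex^'n^'n" where
  "basis_proj k = (\<chi> i j. if i = k \<and> j = k then 1 else 0)"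

definition max_mixed :: "complex^'n^'n" where
  "max_mixed = mat (1 / of_nat CARD('n))"

text \<open>Partial trace over the first register.\<close>

definition ptrace_fst :: "complex^('a::finite \<times> 'b::finite)^('a \<times> 'b) \<Rightarrow> complex^'b^'b" where
  "ptrace_fst A = (\<chi> i j. \<Sum>k\<in>UNIV. A $ (k, i) $ (k, j))"

definition ccq_state ::
  "complex^('f \<times> ('f^'t::finite) \<times> 'e::finite)^('f \<times> ('f^'t) \<times> 'e) \<Rightarrow>
   ('f::{field,finite} \<Rightarrow> 'f^'t \<Rightarrow> complex^'e^'e) \<Rightarrow> bool" where
  "ccq_state \<rho> \<rho>E \<longleftrightarrow>
     \<rho> = (\<Sum>x0\<in>UNIV. \<Sum>x\<in>UNIV. kron (basis_proj x0) (kron (basis_proj x) (\<rho>E x0 x))) \<and>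
     (\<forall>x0 x. pos_semidef (\<rho>E x0 x)) \<and> trace \<rho> = 1"

definition dot_prod :: "'f::comm_ring_1^'t \<Rightarrow> 'f^'t \<Rightarrow> 'f" where
  "dot_prod a x = (\<Sum>i\<in>UNIV. a $ i * x $ i)"

text \<open>The joint state of \<open>Z = X\<^sub>0 + \<langle>a, X\<rangle>\<close> and \<open>E\<close>.\<close>

definition state_ZE ::
  "('f::{field,finite} \<Rightarrow> 'f^'t::finite \<Rightarrow> complex^'e::finite^'e) \<Rightarrow> 'f^'t \<Rightarrow> complex^('f \<times> 'e)^('f \<times> 'e)" where
  "state_ZE \<rho>E a =
     (\<Sum>z\<in>UNIV. kron (basis_proj z)
       (\<Sum>(x0, x)\<in>{(x0, x). x0 + dot_prod a x = z}. \<rho>E x0 x))"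

end

theory Submission
  imports Defs
begin

text \<open>
  Write \<open>\<sigma>\<close> for the operator whose trace norm is to be bounded, with blocks
  \<open>\<sigma> x\<^sub>0 x = \<rho>E x\<^sub>0 x - (\<Sum>y. \<rho>E y x) / p\<close>, and let \<open>T\<close> be a positive definite perturbation of \<open>\<rho>\<^sub>E\<close>.
  By Cauchy-Schwarz, the squared trace norm of \<open>\<sigma>\<close> is at most \<open>p ^ (t + 1) * tr T\<close> times the squared
  Hilbert-Schmidt norm of \<open>\<sigma>\<close> conjugated with \<open>T powr (-1/4)\<close>. Since \<open>(\<Sum>x\<^sub>0. \<sigma> x\<^sub>0 x) = 0\<close> for all \<open>x\<close>, this
  weighted norm is the average over \<open>a\<close> of the same norm for the deviation of the state of \<open>Z\<close> and \<open>E\<close>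
  from uniform. The blocks \<open>D\<close> of the deviation satisfy \<open>-T \<le> D \<le> T\<close>, so \<open>T powr (-1/2) D T powr (-1/2)\<close>
  is a contraction, and pairing \<open>D\<close> with it bounds the squared weighted norm by the trace norm, which is
  at most \<open>2 * \<epsilon>\<close>. All of this is computed in an eigenbasis of \<open>\<rho>\<^sub>E\<close>.
\<close>

section \<open>Complex inner product, adjoints and diagonal matrices\<close>

definition cdot :: "complex^'n \<Rightarrow> complex^'n \<Rightarrow> complex" where
  "cdot u v = (\<Sum>i\<in>UNIV. cnj (u $ i) * v $ i)"

definition diag_mat :: "('n \<Rightarrow> real) \<Rightarrow> complex^'n^'n" where
  "diag_mat d = (\<chi> i j. if i = j then of_real (d i) else 0)"

text \<open>One-sided, since a left inverse of a square matrix is also a right inverse;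
  \<open>unitaryD\<close> recovers both identities.\<close>

definition unitary :: "complex^'n^'n \<Rightarrow> bool" where
  "unitary U \<longleftrightarrow> conj_transpose U ** U = mat 1"

lemma unitaryD:
  assumes "unitary U"
  shows "conj_transpose U ** U = mat 1" "U ** conj_transpose U = mat 1"
  using assms matrix_left_right_inverse unfolding unitary_def by blast+

lemma conj_transpose_mult [simp]:
  "conj_transpose (A ** B) = conj_transpose B ** conj_transpose A"
  by (simp add: conj_transpose_def matrix_matrix_mult_def vec_eq_iff mult.commute)

lemma conj_transpose_conj_transpose [simp]: "conj_transpose (conj_transpose A) = A"
  by (simp add: conj_transpose_def vec_eq_iff)

lemma conj_transpose_diag_mat [simp]: "conj_transpose (diag_mat d) = diag_mat d"
  by (simp add: conj_transpose_def diag_mat_def vec_eq_iff)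

lemma conj_transpose_add: "conj_transpose (A + B) = conj_transpose A + conj_transpose B"
  by (simp add: conj_transpose_def vec_eq_iff)

lemma conj_transpose_diff: "conj_transpose (A - B) = conj_transpose A - conj_transpose B"
  by (simp add: conj_transpose_def vec_eq_iff)

lemma conj_transpose_scaleR: "conj_transpose (c *\<^sub>R A) = c *\<^sub>R conj_transpose A"
  by (simp add: conj_transpose_def vec_eq_iff)

lemma conj_transpose_sum: "conj_transpose (\<Sum>x\<in>X. F x) = (\<Sum>x\<in>X. conj_transpose (F x))"
  by (simp add: conj_transpose_def vec_eq_iff)

lemma diag_mat_mult_nth: "(diag_mat d ** A) $ i $ j = of_real (d i) * A $ i $ j"
  by (simp add: diag_mat_def matrix_matrix_mult_def if_distrib[of "\<lambda>x. x * _"] cong: if_cong)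

lemma diag_mat_mult: "diag_mat d ** diag_mat e = diag_mat (\<lambda>i. d i * e i)"
  by (simp add: vec_eq_iff diag_mat_mult_nth) (simp add: diag_mat_def)

lemma diag_mat_one: "diag_mat (\<lambda>_. 1) = mat 1"
  by (simp add: diag_mat_def mat_def vec_eq_iff)

lemma cdot_diag_mat: "cdot v (diag_mat d *v v) = of_real (\<Sum>i\<in>UNIV. d i * (cmod (v $ i))\<^sup>2)"
proof -
  have "(diag_mat d *v v) $ i = of_real (d i) * v $ i" for i
    by (simp add: diag_mat_def matrix_vector_mult_def if_distrib[of "\<lambda>x. x * _"] cong: if_cong)
  then show ?thesis
    unfolding cdot_def of_real_sum
    by (intro sum.cong) (simp_all add: complex_norm_square mult_ac del: of_real_power)
qed

lemma trace_diag_mat: "trace (diag_mat d) = of_real (\<Sum>i\<in>UNIV. d i)"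
  by (simp add: trace_def diag_mat_def)

lemma cdot_simps:
  "cdot u (v + w) = cdot u v + cdot u w"
  "cdot (u + v) w = cdot u w + cdot v w"
  "cdot u (v - w) = cdot u v - cdot u w"
  "cdot (u - v) w = cdot u w - cdot v w"
  "cdot u (c *s v) = c * cdot u v"
  "cdot (c *s u) v = cnj c * cdot u v"
  "cdot u 0 = 0"
  by (simp_all add: cdot_def algebra_simps sum.distrib sum_subtractf sum_distrib_left)

lemma cnj_cdot: "cnj (cdot u v) = cdot v u"
  by (simp add: cdot_def mult.commute)

lemma Re_cdot: "Re (cdot u v) = inner u v"
  by (simp add: cdot_def inner_vec_def inner_complex_def)

lemma cdot_self: "cdot v v = of_real ((norm v)\<^sup>2)"
proof -
  have "Im (cdot v v) = 0"
    using cnj_cdot[of v v] by (metis complex_cnj_cancel_iff Reals_cnj_iff complex_is_Real_iff)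
  then show ?thesis
    by (simp add: complex_eq_iff Re_cdot power2_norm_eq_inner)
qed

lemma cdot_conj_transpose: "cdot u (A *v v) = cdot (conj_transpose A *v u) v"
proof -
  have "cdot u (A *v v) = (\<Sum>i\<in>UNIV. \<Sum>j\<in>UNIV. cnj (u $ i) * A $ i $ j * v $ j)"
    by (simp add: cdot_def matrix_vector_mult_def sum_distrib_left mult_ac)
  also have "\<dots> = (\<Sum>j\<in>UNIV. \<Sum>i\<in>UNIV. cnj (u $ i) * A $ i $ j * v $ j)"
    by (rule sum.swap)
  also have "\<dots> = cdot (conj_transpose A *v u) v"
    by (simp add: cdot_def matrix_vector_mult_def conj_transpose_def sum_distrib_left
        sum_distrib_right mult_ac)
  finally show ?thesis .
qed

text \<open>Reads off matrix entries in the basis formed by the columns. With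
  \<open>A = mat 1\<close> it turns unitarity into orthonormality of the columns, and
  conversely.\<close>

lemma conj_mult_nth:
  "(conj_transpose U ** A ** V) $ i $ j = cdot (column i U) (A *v column j V)"
proof -
  have "(conj_transpose U ** A ** V) $ i $ j = (conj_transpose U ** (A ** V)) $ i $ j"
    by (simp add: matrix_mul_assoc)
  then show ?thesis
    by (simp add: matrix_matrix_mult_def conj_transpose_def cdot_def matrix_vector_mult_def
        column_def)
qed

lemma cdot_scaleR_mult: "cdot v ((c *\<^sub>R A) *v w) = of_real c * cdot v (A *v w)"
  by (simp add: cdot_def matrix_vector_mult_def)
    (simp add: sum_distrib_left scaleR_conv_of_real mult_ac)

lemma conjugate_add: "V ** (A + B) ** W = V ** A ** W + V ** B ** (W :: complex^'n^'n)"
  by (simp add: matrix_add_ldistrib) (simp add: matrix_matrix_mult_def vec_eq_iff algebra_simps sum.distrib)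

lemma conjugate_scaleR: "V ** (c *\<^sub>R A) ** W = c *\<^sub>R (V ** A ** (W :: complex^'n^'n))"
  by (simp add: matrix_matrix_mult_def vec_eq_iff scaleR_sum_right sum_distrib_right)

lemma linear_conjugate: "linear (\<lambda>A. V ** A ** (W :: complex^'n^'n))"
  by (intro linearI conjugate_add conjugate_scaleR)

lemma trace_sum: "trace (\<Sum>x\<in>X. F x) = (\<Sum>x\<in>X. trace (F x))"
  unfolding trace_def sum_component by (rule sum.swap)

lemma trace_conjugate: "unitary V \<Longrightarrow> trace (conj_transpose V ** A ** V) = trace A"
  by (subst trace_mul_sym) (simp add: matrix_mul_assoc unitaryD)

section \<open>The spectral theorem for Hermitian matrices\<close>

text \<open>First-order optimality: the form \<open>B\<close> is nonnegative on \<open>W\<close> and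
  vanishes at \<open>v0\<close>, so its variation at \<open>v0\<close> in the direction of the
  residual \<open>w\<close> must vanish. That variation is a multiple of the squared norm of
  \<open>w\<close>, and invariance of \<open>W\<close> makes \<open>w\<close> an admissible
  direction.\<close>

lemma max_on_subspace_imp_eigenvector:
  fixes A :: "complex^'n^'n"
  assumes herm: "conj_transpose A = A"
    and W: "subspace W" "\<And>v. v \<in> W \<Longrightarrow> A *v v \<in> W"
    and v0: "v0 \<in> W" "norm v0 = 1" "l = inner v0 (A *v v0)"
    and max: "\<And>v. v \<in> W \<Longrightarrow> norm v = 1 \<Longrightarrow> inner v (A *v v) \<le> l"
  shows "A *v v0 = l *\<^sub>R v0"
proof -
  have lin: "linear ((*v) A)"
    by (rule linearI)
      (simp_all add: matrix_vector_mult_def vec_eq_iff scaleR_sum_right sum.distrib distrib_left)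
  define B where "B v = l * inner v v - inner v (A *v v)" for v
  have B_nonneg: "0 \<le> B v" if "v \<in> W" for v
  proof (cases "v = 0")
    case False
    define s where "s = inverse (norm v)"
    have "inner (s *\<^sub>R v) (A *v (s *\<^sub>R v)) \<le> l"
      using W(1) that False by (intro max) (auto simp: s_def subspace_scale)
    then have "s\<^sup>2 * inner v (A *v v) \<le> l"
      by (simp add: linear_cmul[OF lin] power2_eq_square)
    then show ?thesis
      using False by (simp add: s_def B_def field_simps flip: power2_norm_eq_inner)
  qed (simp add: B_def)
  define w where "w = A *v v0 - l *\<^sub>R v0"
  have wW: "w \<in> W"
    unfolding w_def using W v0(1) by (intro subspace_diff subspace_scale) auto
  have v0v0: "inner v0 v0 = 1"
    using v0(2) by (simp flip: power2_norm_eq_inner)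
  have sym: "inner u (A *v v) = inner (A *v u) v" for u v
    using arg_cong[OF cdot_conj_transpose[of u A v], of Re] by (simp add: Re_cdot herm)
  have wv0: "inner w v0 = 0"
    using v0v0 v0(3) by (simp add: w_def inner_diff_left sym)
  have wAv0: "inner w (A *v v0) = inner w w"
  proof -
    have "A *v v0 = w + l *\<^sub>R v0"
      by (simp add: w_def)
    then show ?thesis
      by (simp only: inner_add_right inner_scaleR_right wv0 mult_zero_right add_0_right)
  qed
  have v0Aw: "inner v0 (A *v w) = inner w w"
    using wAv0 by (simp only: sym[of v0 w] inner_commute[of "A *v v0" w])
  have B_expand: "B (v0 + t *\<^sub>R w) = t * (t * B w - 2 * inner w w)" for t
    using v0v0 v0(3) wv0 wAv0 v0Aw
    by (simp add: B_def linear_add[OF lin] linear_cmul[OF lin] inner_add_left inner_add_right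
        inner_commute[of v0 w] algebra_simps power2_eq_square)
  have "inner w w = 0"
  proof (rule ccontr)
    assume neq: "inner w w \<noteq> 0"
    \<comment> \<open>For \<open>w\<close> nonzero, this step makes the quadratic term
      \<open>t * B w\<close> at most \<open>inner w w\<close>, too small to offset
      \<open>- 2 * inner w w\<close>, so \<open>B\<close> would become negative. The added 1 keeps
      the denominator positive when \<open>B w = 0\<close>.\<close>
    define t where "t = inner w w / (B w + 1)"
    have pos: "0 < inner w w" "0 < B w + 1" "0 < t"
      using neq B_nonneg[OF wW] inner_ge_zero[of w] unfolding t_def
      by (auto simp: less_le intro: divide_nonneg_nonneg)
    have "0 \<le> B (v0 + t *\<^sub>R w)"
      using W(1) v0(1) wW by (intro B_nonneg subspace_add subspace_scale)
    then have "0 \<le> t * B w - 2 * inner w w"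
      using pos(3) by (simp add: B_expand zero_le_mult_iff)
    moreover have "t * B w \<le> inner w w"
      using pos B_nonneg[OF wW] by (simp add: t_def field_simps)
    ultimately show False
      using pos(1) by linarith
  qed
  then show ?thesis
    by (simp add: w_def)
qed

text \<open>Stack the conditions as rows of a square matrix \<open>M\<close>. An index
  \<open>k\<close> outside \<open>S\<close> gives a zero row, so \<open>M\<close> has no right
  inverse, hence no left inverse, hence a nontrivial kernel.\<close>

lemma exists_orthogonal_vector:
  fixes u :: "'n::finite \<Rightarrow> complex^'n"
  assumes "S \<noteq> UNIV"
  obtains v where "v \<noteq> 0" "\<forall>i\<in>S. cdot (u i) v = 0"
proof -
  obtain k where k: "k \<notin> S"
    using assms by auto
  define M :: "complex^'n^'n" where "M = (\<chi> i j. if i \<in> S then cnj (u i $ j) else 0)"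
  have "\<exists>v. v \<noteq> 0 \<and> M *v v = 0"
  proof (rule ccontr)
    assume "\<not> ?thesis"
    then obtain B where "B ** M = mat 1"
      using matrix_left_invertible_ker[of M] by blast
    then have "M ** B = mat 1"
      using matrix_left_right_inverse by blast
    then have "(M ** B) $ k $ k = 1"
      by (simp add: mat_def)
    then show False
      using k by (simp add: M_def matrix_matrix_mult_def)
  qed
  then obtain v where v: "v \<noteq> 0" "M *v v = 0"
    by blast
  have "cdot (u i) v = 0" if "i \<in> S" for i
  proof -
    have "(M *v v) $ i = 0"
      using v(2) by simp
    then show ?thesis
      using that by (simp add: M_def matrix_vector_mult_def cdot_def)
  qed
  with v(1) show thesis
    by (intro that) auto
qed

text \<open>Induction on the index set: the orthogonal complement \<open>W\<close> of the
  eigenvectors found so far is nonzero and invariant under \<open>A\<close>, and a maximiser of the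
  quadratic form on its compact unit sphere is the next eigenvector. Taking \<open>S = UNIV\<close>
  gives a full eigenbasis.\<close>

lemma orthonormal_eigenvectors:
  fixes A :: "complex^'n^'n" and S :: "'n::finite set"
  assumes herm: "conj_transpose A = A"
  shows "\<exists>u l. (\<forall>i\<in>S. \<forall>j\<in>S. cdot (u i) (u j) = (if i = j then 1 else 0)) \<and>
    (\<forall>i\<in>S. A *v u i = complex_of_real (l i) *s u i)"
proof (induction S rule: finite_induct[OF finite])
  case 1
  then show ?case by simp
next
  case (2 k S)
  then obtain u l where
    orth: "\<And>i j. i \<in> S \<Longrightarrow> j \<in> S \<Longrightarrow> cdot (u i) (u j) = (if i = j then 1 else 0)" and
    eig: "\<And>i. i \<in> S \<Longrightarrow> A *v u i = complex_of_real (l i) *s u i"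
    by blast
  define W where "W = {v. \<forall>i\<in>S. cdot (u i) v = 0}"
  have scaleR: "c *\<^sub>R v = complex_of_real c *s v" for c and v :: "complex^'n"
    by (simp add: vec_eq_iff) (simp add: scaleR_conv_of_real)
  have W: "subspace W"
    by (auto simp: W_def subspace_def cdot_simps scaleR)
  have AW: "A *v v \<in> W" if "v \<in> W" for v
    using that eig by (simp add: W_def cdot_conj_transpose herm cdot_simps)
  have "S \<noteq> UNIV"
    using \<open>k \<notin> S\<close> by auto
  then obtain v1 where "v1 \<noteq> 0" "\<forall>i\<in>S. cdot (u i) v1 = 0"
    by (rule exists_orthogonal_vector)
  then have v1: "v1 \<noteq> 0" "v1 \<in> W"
    by (simp_all add: W_def)
  define K where "K = W \<inter> sphere 0 1"
  have "closed W"
    using W by (rule closed_subspace)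
  then have "compact K"
    unfolding K_def by (intro closed_Int_compact) auto
  moreover have "v1 /\<^sub>R norm v1 \<in> K"
    using v1 W by (auto simp: K_def subspace_scale)
  then have "K \<noteq> {}"
    by blast
  moreover have "continuous_on K (\<lambda>v. inner v (A *v v))"
    by (intro continuous_intros)
  ultimately obtain v0 where v0: "v0 \<in> K" "\<And>v. v \<in> K \<Longrightarrow> inner v (A *v v) \<le> inner v0 (A *v v0)"
    using continuous_attains_sup by meson
  define m where "m = inner v0 (A *v v0)"
  have v0': "A *v v0 = complex_of_real m *s v0"
    using max_on_subspace_imp_eigenvector[OF herm W AW, of v0 m] v0
    by (simp add: K_def m_def scaleR)
  have "cdot v0 v0 = 1" "\<And>i. i \<in> S \<Longrightarrow> cdot (u i) v0 = 0"
    using v0(1) by (auto simp: K_def W_def cdot_self)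
  moreover from this have "\<And>i. i \<in> S \<Longrightarrow> cdot v0 (u i) = 0"
    by (metis cnj_cdot complex_cnj_zero)
  ultimately show ?case
    using v0' orth eig \<open>k \<notin> S\<close>
    by (intro exI[of _ "u(k := v0)"] exI[of _ "l(k := m)"]) auto
qed

theorem spectral_theorem_hermitian:
  fixes A :: "complex^'n^'n"
  assumes "conj_transpose A = A"
  obtains U d where "unitary U" "A = U ** diag_mat d ** conj_transpose U"
proof -
  obtain u :: "'n \<Rightarrow> complex^'n" and d where
    orth: "\<And>i j. cdot (u i) (u j) = (if i = j then 1 else 0)" and
    eig: "\<And>i. A *v u i = complex_of_real (d i) *s u i"
    using orthonormal_eigenvectors[OF assms, of UNIV] by auto
  define U where "U = (\<chi> i j. u j $ i)"
  have col: "column j U = u j" for j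
    by (simp add: U_def column_def vec_eq_iff)
  have "(conj_transpose U ** U) $ i $ j = mat 1 $ i $ j" for i j
    using conj_mult_nth[of U "mat 1" U i j] by (simp add: col orth) (simp add: mat_def)
  then have U: "unitary U"
    by (simp add: unitary_def vec_eq_iff)
  have "(conj_transpose U ** A ** U) $ i $ j = diag_mat d $ i $ j" for i j
    by (simp add: conj_mult_nth col eig cdot_simps orth diag_mat_def)
  then have "conj_transpose U ** A ** U = diag_mat d"
    by (simp add: vec_eq_iff)
  then have "U ** diag_mat d ** conj_transpose U = U ** (conj_transpose U ** A ** U) ** conj_transpose U"
    by simp
  also have "\<dots> = (U ** conj_transpose U) ** A ** (U ** conj_transpose U)"
    by (simp only: matrix_mul_assoc)
  finally have "A = U ** diag_mat d ** conj_transpose U"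
    by (simp add: unitaryD[OF U])
  with U show thesis
    by (rule that)
qed

section \<open>The trace norm of a Hermitian matrix\<close>

lemma pos_semidef_cdot:
  "pos_semidef A \<longleftrightarrow> conj_transpose A = A \<and> (\<forall>v. 0 \<le> Re (cdot v (A *v v)))"
  by (simp add: pos_semidef_def cdot_def)

lemma cdot_conjugate:
  "cdot v ((U ** A ** conj_transpose U) *v v)
    = cdot (conj_transpose U *v v) (A *v (conj_transpose U *v v))"
  using cdot_conj_transpose[of v U "A *v (conj_transpose U *v v)"]
  by (simp add: matrix_vector_mul_assoc matrix_mul_assoc)

lemma pos_semidef_conjugate:
  assumes "pos_semidef A"
  shows "pos_semidef (U ** A ** conj_transpose U)"
  using assms unfolding pos_semidef_cdot cdot_conjugate by (simp add: matrix_mul_assoc)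

lemma pos_semidef_diag_mat:
  assumes "\<And>i. 0 \<le> d i"
  shows "pos_semidef (diag_mat d)"
  using assms by (simp add: pos_semidef_cdot cdot_diag_mat sum_nonneg)

lemma pos_semidef_0: "pos_semidef 0"
  by (simp add: pos_semidef_cdot conj_transpose_def vec_eq_iff cdot_def)

lemma pos_semidef_add:
  assumes "pos_semidef A" "pos_semidef B"
  shows "pos_semidef (A + B)"
  using assms
  by (simp add: pos_semidef_cdot conj_transpose_add matrix_vector_mult_add_rdistrib cdot_simps)

lemma pos_semidef_sum: "(\<And>x. x \<in> X \<Longrightarrow> pos_semidef (F x)) \<Longrightarrow> pos_semidef (\<Sum>x\<in>X. F x)"
  by (induction X rule: infinite_finite_induct) (simp_all add: pos_semidef_0 pos_semidef_add)

lemma cdot_pos_semidef: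
  assumes "pos_semidef A"
  obtains r where "0 \<le> r" "cdot v (A *v v) = complex_of_real r"
proof
  have "cnj (cdot v (A *v v)) = cdot v (A *v v)"
    using assms by (simp add: cnj_cdot cdot_conj_transpose pos_semidef_cdot)
  then show "cdot v (A *v v) = complex_of_real (Re (cdot v (A *v v)))"
    by (metis Reals_cnj_iff of_real_Re)
qed (use assms in \<open>simp add: pos_semidef_cdot\<close>)

text \<open>If \<open>B\<^sup>2 = C\<^sup>2\<close>, then \<open>D = B - C\<close> satisfies \<open>D (B + C) + (B + C) D = 0\<close>, so an eigenvector of
  \<open>D\<close> for a nonzero eigenvalue is isotropic for \<open>B + C\<close>, hence for \<open>B\<close>, \<open>C\<close> and \<open>D\<close>,
  which contradicts the eigenvalue being nonzero.\<close>

lemma pos_semidef_root_unique: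
  fixes B C :: "complex^'n^'n"
  assumes B: "pos_semidef B" and C: "pos_semidef C" and eq: "B ** B = C ** C"
  shows "B = C"
proof -
  define D where "D = B - C"
  have hB: "conj_transpose B = B" and hC: "conj_transpose C = C"
    using B C by (auto simp: pos_semidef_cdot)
  have hD: "conj_transpose D = D"
    by (simp add: D_def conj_transpose_diff hB hC)
  obtain U d where U: "unitary U" and D: "D = U ** diag_mat d ** conj_transpose U"
    using spectral_theorem_hermitian[OF hD] .
  have "d i = 0" for i
  proof (rule ccontr)
    assume di: "d i \<noteq> 0"
    define w where "w = column i U"
    have Dw: "D *v w = complex_of_real (d i) *s w"
    proof -
      have "D ** U = U ** diag_mat d ** (conj_transpose U ** U)"
        by (simp add: D matrix_mul_assoc)
      then have DU: "D ** U = U ** diag_mat d"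
        by (simp add: unitaryD[OF U])
      have "(D *v w) $ k = (D ** U) $ k $ i" for k
        by (simp add: w_def column_def matrix_vector_mult_def matrix_matrix_mult_def)
      then show ?thesis
        unfolding vec_eq_iff DU
        by (simp add: w_def column_def matrix_matrix_mult_def diag_mat_def
            if_distrib[of "\<lambda>x. _ * x"] mult.commute cong: if_cong)
    qed
    have "D ** (B + C) + (B + C) ** D = 0"
      using eq unfolding D_def matrix_matrix_mult_def vec_eq_iff
      by (simp add: algebra_simps sum.distrib sum_subtractf)
    then have "cdot w ((D ** (B + C) + (B + C) ** D) *v w) = 0"
      by (simp add: cdot_simps)
    then have "cdot (D *v w) ((B + C) *v w) + cdot w ((B + C) *v (D *v w)) = 0"
      by (simp add: matrix_vector_mult_add_rdistrib cdot_simps hD cdot_conj_transpose[of w D]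
          flip: matrix_vector_mul_assoc)
    then have "cdot w ((B + C) *v w) = 0"
      using di by (simp add: Dw cdot_simps vector_scalar_commute flip: distrib_left)
    then have "Re (cdot w (B *v w)) + Re (cdot w (C *v w)) = 0"
      by (simp add: matrix_vector_mult_add_rdistrib cdot_simps flip: plus_complex.sel)
    moreover have "0 \<le> Re (cdot w (B *v w))" "0 \<le> Re (cdot w (C *v w))"
      using B C by (auto simp: pos_semidef_cdot)
    ultimately have "Re (cdot w (D *v w)) = 0"
      by (simp add: D_def matrix_vector_mult_diff_rdistrib cdot_simps)
    moreover have "cdot w w = 1"
      using conj_mult_nth[of U "mat 1" U i i]
      by (simp add: w_def unitaryD[OF U]) (simp add: mat_def)
    ultimately show False
      using di by (simp add: Dw cdot_simps)
  qed
  then have "diag_mat d = 0"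
    by (simp add: diag_mat_def vec_eq_iff)
  then show ?thesis
    using D by (simp add: D_def)
qed

text \<open>Conjugating the absolute values of the eigenvalues gives one positive root of the square
  of the matrix. Uniqueness of that root is what resolves the definite description in
  \<open>psd_sqrt\<close>.\<close>

lemma trace_norm_conjugate_diag:
  assumes U: "unitary U"
  shows "trace_norm (U ** diag_mat d ** conj_transpose U) = (\<Sum>i\<in>UNIV. \<bar>d i\<bar>)"
proof -
  define A where "A = U ** diag_mat d ** conj_transpose U"
  define B where "B = U ** diag_mat (\<lambda>i. \<bar>d i\<bar>) ** conj_transpose U"
  have mult: "(U ** diag_mat f ** conj_transpose U) ** (U ** diag_mat g ** conj_transpose U)
      = U ** diag_mat (\<lambda>i. f i * g i) ** conj_transpose U" for f g
  proof -
    have "(U ** diag_mat f ** conj_transpose U) ** (U ** diag_mat g ** conj_transpose U)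
        = U ** diag_mat f ** (conj_transpose U ** U) ** diag_mat g ** conj_transpose U"
      by (simp add: matrix_mul_assoc)
    then show ?thesis
      by (simp add: unitaryD[OF U] diag_mat_mult flip: matrix_mul_assoc)
  qed
  have "pos_semidef B"
    unfolding B_def by (intro pos_semidef_conjugate pos_semidef_diag_mat) simp
  moreover have "B ** B = conj_transpose A ** A"
    using mult[of d d] mult[of "\<lambda>i. \<bar>d i\<bar>" "\<lambda>i. \<bar>d i\<bar>"] by (simp add: A_def B_def matrix_mul_assoc)
  ultimately have "psd_sqrt (conj_transpose A ** A) = B"
    unfolding psd_sqrt_def by (intro the_equality) (auto intro: pos_semidef_root_unique)
  moreover have "trace B = trace (conj_transpose U ** U ** diag_mat (\<lambda>i. \<bar>d i\<bar>))"
    unfolding B_def using trace_mul_sym by (metis matrix_mul_assoc)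
  ultimately show ?thesis
    by (simp add: trace_norm_def A_def unitaryD[OF U] trace_diag_mat)
qed

lemma unitary_mult:
  assumes "unitary U" "unitary V"
  shows "unitary (U ** V)"
proof -
  have "conj_transpose (U ** V) ** (U ** V) = conj_transpose V ** (conj_transpose U ** U) ** V"
    by (simp add: matrix_mul_assoc)
  then show ?thesis
    using assms by (simp add: unitary_def)
qed

lemma unitary_conj_transpose: "unitary U \<Longrightarrow> unitary (conj_transpose U)"
  using unitaryD(2)[of U] by (simp add: unitary_def)

lemma trace_norm_conjugate:
  assumes A: "conj_transpose A = A" and V: "unitary V"
  shows "trace_norm (V ** A ** conj_transpose V) = trace_norm A"
proof -
  obtain U d where U: "unitary U" and d: "A = U ** diag_mat d ** conj_transpose U"
    using spectral_theorem_hermitian[OF A] .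
  have "V ** A ** conj_transpose V = (V ** U) ** diag_mat d ** conj_transpose (V ** U)"
    by (simp add: d matrix_mul_assoc)
  then show ?thesis
    using trace_norm_conjugate_diag[OF U] trace_norm_conjugate_diag[OF unitary_mult[OF V U]] d
    by simp
qed

text \<open>Duality in the eigenbasis of \<open>A\<close>: the trace becomes the sum of the
  eigenvalues times the diagonal entries of \<open>K\<close> in that basis, and these are values of
  the quadratic form of \<open>K\<close> at unit vectors.\<close>

lemma norm_trace_mult_le_trace_norm:
  fixes A K :: "complex^'n^'n"
  assumes A: "conj_transpose A = A"
    and K: "\<And>v. cmod (cdot v (K *v v)) \<le> (norm v)\<^sup>2"
  shows "cmod (trace (A ** K)) \<le> trace_norm A"
proof -
  obtain U d where U: "unitary U" and d: "A = U ** diag_mat d ** conj_transpose U"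
    using spectral_theorem_hermitian[OF A] .
  define L where "L = conj_transpose U ** K ** U"
  have L: "cmod (L $ i $ i) \<le> 1" for i
  proof -
    have "cdot (column i U) (column i U) = 1"
      using conj_mult_nth[of U "mat 1" U i i]
      by (simp add: unitaryD[OF U]) (simp add: mat_def)
    then have "(norm (column i U))\<^sup>2 = 1"
      unfolding cdot_self by (simp only: of_real_eq_1_iff)
    then show ?thesis
      using K[of "column i U"] by (simp add: L_def conj_mult_nth)
  qed
  have "trace (A ** K) = trace (U ** (diag_mat d ** conj_transpose U ** K))"
    by (simp add: d matrix_mul_assoc)
  also have "\<dots> = trace (diag_mat d ** L)"
    unfolding L_def by (subst trace_mul_sym) (simp add: matrix_mul_assoc)
  also have "\<dots> = (\<Sum>i\<in>UNIV. of_real (d i) * L $ i $ i)"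
    by (simp add: trace_def diag_mat_mult_nth)
  finally have "cmod (trace (A ** K)) \<le> (\<Sum>i\<in>UNIV. cmod (of_real (d i) * L $ i $ i))"
    by (simp add: norm_sum)
  also have "\<dots> \<le> (\<Sum>i\<in>UNIV. \<bar>d i\<bar>)"
    using L by (intro sum_mono) (simp add: norm_mult mult_left_le)
  finally show ?thesis
    using trace_norm_conjugate_diag[OF U] d by simp
qed

lemma trace_norm_eq_trace_unitary:
  fixes A :: "complex^'n^'n"
  assumes A: "conj_transpose A = A"
  obtains S where "unitary S" "trace (A ** S) = of_real (trace_norm A)"
proof -
  obtain U d where U: "unitary U" and d: "A = U ** diag_mat d ** conj_transpose U"
    using spectral_theorem_hermitian[OF A] .
  \<comment> \<open>The sign of \<open>d i\<close>, except that zero eigenvalues get the value 1, so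
    that \<open>S\<close> is unitary and not merely a partial isometry.\<close>
  define s where "s i = (if d i < 0 then -1 else 1 :: real)" for i
  define S where "S = U ** diag_mat s ** conj_transpose U"
  have ss: "s i * s i = 1" for i
    by (simp add: s_def)
  have "unitary (diag_mat s)"
    by (simp add: unitary_def diag_mat_mult ss diag_mat_one)
  then have "unitary S"
    unfolding S_def using U by (intro unitary_mult unitary_conj_transpose)
  moreover have "trace (A ** S) = of_real (trace_norm A)"
  proof -
    have "A ** S = U ** diag_mat d ** (conj_transpose U ** U) ** diag_mat s ** conj_transpose U"
      by (simp add: d S_def matrix_mul_assoc)
    also have "\<dots> = U ** (diag_mat (\<lambda>i. d i * s i) ** conj_transpose U)"
      by (simp add: unitaryD[OF U] diag_mat_mult flip: matrix_mul_assoc)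
    also have "trace \<dots> = trace (diag_mat (\<lambda>i. d i * s i) ** (conj_transpose U ** U))"
      by (subst trace_mul_sym) (simp add: matrix_mul_assoc)
    also have "\<dots> = of_real (\<Sum>i\<in>UNIV. \<bar>d i\<bar>)"
      by (simp add: unitaryD[OF U] trace_diag_mat s_def abs_if if_distrib cong: if_cong)
    finally show ?thesis
      using trace_norm_conjugate_diag[OF U] d by simp
  qed
  ultimately show thesis
    by (rule that)
qed

lemma unitary_sum_norm_squares:
  assumes "unitary S"
  shows "(\<Sum>i\<in>UNIV. (cmod (S $ i $ j))\<^sup>2) = 1" "(\<Sum>j\<in>UNIV. (cmod (S $ i $ j))\<^sup>2) = 1"
proof -
  have "(\<Sum>i\<in>UNIV. (cmod (V $ i $ j))\<^sup>2) = 1" if "unitary V" for V :: "complex^'n^'n" and j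
  proof -
    have "(conj_transpose V ** V) $ j $ j = complex_of_real (\<Sum>i\<in>UNIV. (cmod (V $ i $ j))\<^sup>2)"
      unfolding of_real_sum complex_norm_square
      by (simp add: matrix_matrix_mult_def conj_transpose_def mult.commute)
    then show ?thesis
      using that by (simp add: unitary_def mat_def del: of_real_sum)
  qed
  from this[OF assms] this[OF unitary_conj_transpose[OF assms]]
  show "(\<Sum>i\<in>UNIV. (cmod (S $ i $ j))\<^sup>2) = 1" "(\<Sum>j\<in>UNIV. (cmod (S $ i $ j))\<^sup>2) = 1"
    by (simp_all add: conj_transpose_def)
qed

section \<open>Weighted Hilbert-Schmidt norms\<close>

text \<open>The squared Hilbert-Schmidt norm of \<open>A\<close> conjugated with \<open>T powr (-1/4)\<close>, where \<open>T\<close> is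
  diagonal with entries \<open>m\<close>.\<close>

definition weighted_hs :: "('n \<Rightarrow> real) \<Rightarrow> complex^'n^'n \<Rightarrow> real" where
  "weighted_hs m A = (\<Sum>i\<in>UNIV. \<Sum>j\<in>UNIV. (cmod (A $ i $ j))\<^sup>2 / sqrt (m i * m j))"

text \<open>Cauchy-Schwarz applied to \<open>trace (A ** S)\<close> for the unitary \<open>S\<close>
  attaining the trace norm, with the weights split between the two factors.\<close>

lemma trace_norm_square_le_weighted_hs:
  fixes A :: "complex^'n^'n"
  assumes A: "conj_transpose A = A" and m: "\<And>i. 0 < m i"
  shows "(trace_norm A)\<^sup>2 \<le> (\<Sum>i\<in>UNIV. m i) * weighted_hs m A"
proof -
  obtain S where S: "unitary S" and tr: "trace (A ** S) = of_real (trace_norm A)"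
    using trace_norm_eq_trace_unitary[OF A] .
  \<comment> \<open>A fourth root, so that its square is the weight in
    \<open>weighted_hs\<close>.\<close>
  define r where "r i j = sqrt (sqrt (m i * m j))" for i j
  have r: "0 < r i j" "(r i j)\<^sup>2 = sqrt (m i * m j)" for i j
    using m[of i] m[of j] by (simp_all add: r_def)
  have "\<bar>trace_norm A\<bar> = cmod (trace (A ** S))"
    by (simp add: tr)
  also have "\<dots> = cmod (\<Sum>i\<in>UNIV. \<Sum>j\<in>UNIV. A $ i $ j * S $ j $ i)"
    by (simp add: trace_def matrix_matrix_mult_def)
  also have "\<dots> \<le> (\<Sum>i\<in>UNIV. \<Sum>j\<in>UNIV. cmod (A $ i $ j * S $ j $ i))"
    by (rule order.trans[OF norm_sum], rule sum_mono, rule norm_sum)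
  also have "\<dots> = (\<Sum>(i, j)\<in>UNIV. (cmod (A $ i $ j) / r i j) * (r i j * cmod (S $ j $ i)))"
    using r(1) by (simp add: norm_mult sum.cartesian_product less_imp_neq[symmetric])
  finally have "(trace_norm A)\<^sup>2
      \<le> (\<Sum>(i, j)\<in>UNIV. (cmod (A $ i $ j) / r i j) * (r i j * cmod (S $ j $ i)))\<^sup>2"
    by (meson abs_ge_self abs_le_square_iff order_trans)
  also have "\<dots> \<le> (\<Sum>(i, j)\<in>UNIV. (cmod (A $ i $ j) / r i j)\<^sup>2)
      * (\<Sum>(i, j)\<in>UNIV. (r i j * cmod (S $ j $ i))\<^sup>2)"
    unfolding case_prod_beta by (rule Cauchy_Schwarz_ineq_sum)
  also have "(\<Sum>(i, j)\<in>UNIV. (cmod (A $ i $ j) / r i j)\<^sup>2) = weighted_hs m A"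
    by (simp add: weighted_hs_def power_divide r(2) sum.cartesian_product)
  also have "weighted_hs m A * (\<Sum>(i, j)\<in>UNIV. (r i j * cmod (S $ j $ i))\<^sup>2)
      \<le> weighted_hs m A * (\<Sum>i\<in>UNIV. m i)"
  proof (rule mult_left_mono)
    have "(\<Sum>(i, j)\<in>UNIV. (r i j * cmod (S $ j $ i))\<^sup>2)
        = (\<Sum>i\<in>UNIV. \<Sum>j\<in>UNIV. sqrt (m i * m j) * (cmod (S $ j $ i))\<^sup>2)"
      by (simp add: power_mult_distrib r(2) sum.cartesian_product)
    \<comment> \<open>The arithmetic-geometric mean inequality decouples the weights; the unit rows
      and columns of \<open>S\<close> then leave half of the total weight in each of the two
      sums.\<close>
    also have "\<dots> \<le> (\<Sum>i\<in>UNIV. \<Sum>j\<in>UNIV. (m i + m j) / 2 * (cmod (S $ j $ i))\<^sup>2)"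
      using m by (intro sum_mono mult_right_mono arith_geo_mean_sqrt) (auto intro: less_imp_le)
    also have "\<dots> = (\<Sum>i\<in>UNIV. \<Sum>j\<in>UNIV. m i / 2 * (cmod (S $ j $ i))\<^sup>2)
        + (\<Sum>j\<in>UNIV. \<Sum>i\<in>UNIV. m j / 2 * (cmod (S $ j $ i))\<^sup>2)"
      by (subst (3) sum.swap) (simp add: add_divide_distrib distrib_right sum.distrib)
    also have "\<dots> = (\<Sum>i\<in>UNIV. m i)"
      by (simp add: unitary_sum_norm_squares[OF S] flip: sum_distrib_left sum_divide_distrib)
    finally show "(\<Sum>(i, j)\<in>UNIV. (r i j * cmod (S $ j $ i))\<^sup>2) \<le> (\<Sum>i\<in>UNIV. m i)" .
    show "0 \<le> weighted_hs m A"
      by (simp add: weighted_hs_def sum_nonneg m less_imp_le)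
  qed
  finally show ?thesis
    by (simp only: mult.commute)
qed

text \<open>Pair \<open>A\<close> with its rescaling \<open>K\<close> by
  \<open>T powr (-1/2)\<close> on both sides, \<open>T\<close> being diagonal with entries
  \<open>m\<close>. The domination by \<open>T\<close> says that the quadratic form of
  \<open>K\<close> is bounded by the squared norm, so duality applies, and the pairing equals the
  weighted norm.\<close>

lemma weighted_hs_le_trace_norm:
  fixes A :: "complex^'n^'n"
  assumes A: "conj_transpose A = A" and m: "\<And>i. 0 < m i"
    and bound: "\<And>v. cmod (cdot v (A *v v)) \<le> (\<Sum>i\<in>UNIV. m i * (cmod (v $ i))\<^sup>2)"
  shows "weighted_hs m A \<le> trace_norm A"
proof -
  define K :: "complex^'n^'n" where "K = (\<chi> i j. A $ i $ j / of_real (sqrt (m i * m j)))"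
  have "cmod (cdot v (K *v v)) \<le> (norm v)\<^sup>2" for v
  proof -
    \<comment> \<open>Substituting \<open>T powr (-1/2)\<close> applied to \<open>v\<close> moves
      the rescaling from the matrix to the vector.\<close>
    define w :: "complex^'n" where "w = (\<chi> i. v $ i / of_real (sqrt (m i)))"
    have "cdot v (K *v v) = cdot w (A *v w)"
      by (simp add: cdot_def K_def w_def matrix_vector_mult_def sum_distrib_left real_sqrt_mult
          mult_ac)
    also have "cmod \<dots> \<le> (\<Sum>i\<in>UNIV. m i * (cmod (w $ i))\<^sup>2)"
      by (rule bound)
    also have "\<dots> = (\<Sum>i\<in>UNIV. (cmod (v $ i))\<^sup>2)"
      using m by (intro sum.cong)
        (simp_all add: w_def norm_divide power_divide less_imp_le less_imp_neq[symmetric])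
    also have "\<dots> = (norm v)\<^sup>2"
      by (simp add: norm_vec_def L2_set_def sum_nonneg)
    finally show ?thesis .
  qed
  then have "cmod (trace (A ** K)) \<le> trace_norm A"
    by (rule norm_trace_mult_le_trace_norm[OF A])
  moreover have "trace (A ** K) = of_real (weighted_hs m A)"
  proof -
    have "A $ i $ j * K $ j $ i = of_real ((cmod (A $ i $ j))\<^sup>2 / sqrt (m i * m j))" for i j
    proof -
      \<comment> \<open>Hermiticity replaces the transposed entry by a conjugate, so each product in
        the trace is a squared modulus.\<close>
      have "K $ j $ i = conj_transpose A $ j $ i / of_real (sqrt (m i * m j))"
        by (simp add: K_def A mult.commute)
      then show ?thesis
        unfolding of_real_divide complex_norm_square by (simp add: conj_transpose_def)
    qed
    then show ?thesis
      by (simp add: trace_def matrix_matrix_mult_def weighted_hs_def)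
  qed
  ultimately show ?thesis
    by simp
qed

section \<open>Block diagonal matrices\<close>

text \<open>The general form of an operator that is classical on the first register; two classical
  registers are handled by nesting.\<close>

definition blockdiag :: "('k::finite \<Rightarrow> complex^'n::finite^'n) \<Rightarrow> complex^('k \<times> 'n)^('k \<times> 'n)" where
  "blockdiag F = (\<chi> i j. if fst i = fst j then F (fst i) $ snd i $ snd j else 0)"

lemma sum_UNIV_prod:
  "(\<Sum>x\<in>UNIV. f x) = (\<Sum>a\<in>UNIV. \<Sum>b\<in>UNIV. f (a, b))"
  by (simp add: sum.cartesian_product)

lemma blockdiag_mult: "blockdiag F ** blockdiag G = blockdiag (\<lambda>k. F k ** G k)"
proof -
  have "(blockdiag F ** blockdiag G) $ i $ j = blockdiag (\<lambda>k. F k ** G k) $ i $ j" for i j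
  proof -
    have "(blockdiag F ** blockdiag G) $ i $ j
        = (\<Sum>l\<in>UNIV. if fst i = l then blockdiag (\<lambda>k. F k ** G k) $ i $ j else 0)"
      unfolding matrix_matrix_mult_def blockdiag_def sum_UNIV_prod vec_lambda_beta
      by (intro sum.cong) auto
    then show ?thesis
      by simp
  qed
  then show ?thesis
    by (simp add: vec_eq_iff)
qed

lemma conj_transpose_blockdiag: "conj_transpose (blockdiag F) = blockdiag (\<lambda>k. conj_transpose (F k))"
  by (auto simp: blockdiag_def conj_transpose_def vec_eq_iff)

lemma blockdiag_mat_1: "blockdiag (\<lambda>_. mat 1) = mat 1"
  by (auto simp: blockdiag_def mat_def vec_eq_iff)

lemma blockdiag_diff: "blockdiag F - blockdiag G = blockdiag (\<lambda>k. F k - G k)"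
  by (simp add: blockdiag_def vec_eq_iff)

lemma blockdiag_scaleR: "c *\<^sub>R blockdiag F = blockdiag (\<lambda>k. c *\<^sub>R F k)"
  by (simp add: blockdiag_def vec_eq_iff)

lemma blockdiag_sum: "(\<Sum>x\<in>X. blockdiag (F x)) = blockdiag (\<lambda>k. \<Sum>x\<in>X. F x k)"
  by (simp add: blockdiag_def vec_eq_iff)

lemma trace_blockdiag: "trace (blockdiag F) = (\<Sum>k\<in>UNIV. trace (F k))"
  by (simp add: blockdiag_def trace_def sum_UNIV_prod)

lemma cdot_blockdiag:
  "cdot v (blockdiag F *v v) = (\<Sum>k\<in>UNIV. cdot (\<chi> i. v $ (k, i)) (F k *v (\<chi> i. v $ (k, i))))"
proof -
  have "(blockdiag F *v v) $ (k, i) = (F k *v (\<chi> i. v $ (k, i))) $ i" for k i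
  proof -
    have "(blockdiag F *v v) $ (k, i)
        = (\<Sum>l\<in>UNIV. if k = l then \<Sum>j\<in>UNIV. F k $ i $ j * v $ (l, j) else 0)"
      unfolding matrix_vector_mult_def blockdiag_def sum_UNIV_prod vec_lambda_beta
      by (intro sum.cong) auto
    then show ?thesis
      by (simp add: matrix_vector_mult_def)
  qed
  then show ?thesis
    by (simp add: cdot_def sum_UNIV_prod)
qed

lemma weighted_hs_blockdiag:
  "weighted_hs (\<lambda>i. m (snd i)) (blockdiag F) = (\<Sum>k\<in>UNIV. weighted_hs m (F k))"
proof -
  have "weighted_hs (\<lambda>i. m (snd i)) (blockdiag F)
      = (\<Sum>k\<in>UNIV. \<Sum>i\<in>UNIV. \<Sum>l\<in>UNIV. if k = l then
          \<Sum>j\<in>UNIV. (cmod (F k $ i $ j))\<^sup>2 / sqrt (m i * m j) else 0)"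
    unfolding weighted_hs_def blockdiag_def sum_UNIV_prod vec_lambda_beta
    by (intro sum.cong) auto
  then show ?thesis
    by (simp add: weighted_hs_def)
qed

lemma unitary_blockdiag: "unitary V \<Longrightarrow> unitary (blockdiag (\<lambda>_. V))"
  by (simp add: unitary_def conj_transpose_blockdiag blockdiag_mult blockdiag_mat_1)

lemma trace_norm_blockdiag_conjugate:
  assumes "\<And>k. conj_transpose (F k) = F k" and "unitary V"
  shows "trace_norm (blockdiag (\<lambda>k. V ** F k ** conj_transpose V)) = trace_norm (blockdiag F)"
  using trace_norm_conjugate[OF _ unitary_blockdiag[OF assms(2)], of "blockdiag F"] assms(1)
  by (simp add: conj_transpose_blockdiag blockdiag_mult)

section \<open>Tensor products and partial traces in block form\<close>

lemma kron_sum_right: "kron A (\<Sum>x\<in>X. F x) = (\<Sum>x\<in>X. kron A (F x))"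
  by (simp add: kron_def vec_eq_iff sum_distrib_left)

lemma sum_kron_basis_proj: "(\<Sum>k\<in>UNIV. kron (basis_proj k) (F k)) = blockdiag F"
proof -
  have "(\<Sum>k\<in>UNIV. kron (basis_proj k) (F k) $ i $ j) = blockdiag F $ i $ j" for i j
  proof -
    have "(\<Sum>k\<in>UNIV. kron (basis_proj k) (F k) $ i $ j)
        = (\<Sum>k\<in>UNIV. if fst i = k then blockdiag F $ i $ j else 0)"
      by (intro sum.cong) (auto simp: kron_def basis_proj_def blockdiag_def)
    then show ?thesis
      by simp
  qed
  then show ?thesis
    by (simp add: vec_eq_iff)
qed

lemma kron_max_mixed:
  "kron (max_mixed :: complex^'k^'k) A = blockdiag (\<lambda>_ :: 'k::finite. (1 / real CARD('k)) *\<^sub>R A)"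
  by (simp add: kron_def max_mixed_def mat_def blockdiag_def vec_eq_iff)
    (simp add: scaleR_conv_of_real)

lemma ptrace_fst_blockdiag: "ptrace_fst (blockdiag F) = (\<Sum>k\<in>UNIV. F k)"
  by (simp add: ptrace_fst_def blockdiag_def vec_eq_iff)

section \<open>Averaging over all linear forms\<close>

text \<open>Moving \<open>a\<close> along a coordinate where \<open>y\<close> is nonzero shifts the
  linear form by any prescribed \<open>u\<close>. Averaging over all \<open>u\<close> replaces each
  summand by the full sum of \<open>g\<close>, which is zero.\<close>

lemma sum_dot_prod_eq_0:
  fixes g :: "'f::{field,finite} \<Rightarrow> complex" and y :: "'f^'t::finite"
  assumes g: "(\<Sum>u\<in>UNIV. g u) = 0" and y: "y \<noteq> 0"
  shows "(\<Sum>a\<in>UNIV. g (dot_prod a y)) = 0"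
proof -
  obtain k where k: "y $ k \<noteq> 0"
    using y by (auto simp: vec_eq_iff)
  have shift: "(\<Sum>a\<in>UNIV. g (dot_prod a y)) = (\<Sum>a\<in>UNIV. g (dot_prod a y + u))" for u
  proof -
    have dot: "dot_prod (a + axis k (u / y $ k)) y = dot_prod a y + u" for a
      using k by (simp add: dot_prod_def axis_def distrib_right sum.distrib
          if_distrib[of "\<lambda>x. x * _"] cong: if_cong)
    show ?thesis
      by (rule sum.reindex_bij_witness[where i = "\<lambda>a. a + axis k (u / y $ k)"
            and j = "\<lambda>a. a - axis k (u / y $ k)"]) (auto simp flip: dot)
  qed
  have "of_nat CARD('f) * (\<Sum>a\<in>UNIV. g (dot_prod a y))
      = (\<Sum>u::'f\<in>UNIV. \<Sum>a\<in>UNIV. g (dot_prod a y + u))"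
    by (simp flip: shift)
  also have "\<dots> = (\<Sum>a\<in>UNIV. \<Sum>u\<in>UNIV. g (dot_prod a y + u))"
    by (rule sum.swap)
  also have "\<dots> = (\<Sum>a::'f^'t\<in>UNIV. 0)"
  proof (rule sum.cong)
    fix a :: "'f^'t"
    have "(\<Sum>u\<in>UNIV. g (dot_prod a y + u)) = (\<Sum>u\<in>UNIV. g u)"
      by (rule sum.reindex_bij_witness[where i = "\<lambda>u. u - dot_prod a y"
            and j = "\<lambda>u. dot_prod a y + u"]) auto
    then show "(\<Sum>u\<in>UNIV. g (dot_prod a y + u)) = 0"
      by (simp add: g)
  qed simp
  finally show ?thesis
    by simp
qed

text \<open>Expanding the square, the cross terms for \<open>x \<noteq> y\<close> vanish because \<open>\<langle>a, x - y\<rangle>\<close> is equidistributed.\<close>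

lemma sum_norm_square_linear_form_fibres:
  fixes s :: "'f::{field,finite} \<Rightarrow> 'f^'t::finite \<Rightarrow> complex"
  assumes s: "\<And>x. (\<Sum>x0\<in>UNIV. s x0 x) = 0"
  shows "(\<Sum>a\<in>UNIV. \<Sum>z\<in>UNIV. (cmod (\<Sum>x\<in>UNIV. s (z - dot_prod a x) x))\<^sup>2)
    = real CARD('f) ^ CARD('t) * (\<Sum>x0\<in>UNIV. \<Sum>x\<in>UNIV. (cmod (s x0 x))\<^sup>2)"
proof -
  have cross: "(\<Sum>a\<in>UNIV. \<Sum>z\<in>UNIV. s (z - dot_prod a x) x * cnj (s (z - dot_prod a y) y))
      = (if x = y then of_nat (CARD('f) ^ CARD('t)) * (\<Sum>z\<in>UNIV. s z x * cnj (s z x)) else 0)"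
    for x y
  proof -
    \<comment> \<open>Translating \<open>z\<close> by \<open>dot_prod a x\<close> leaves
      \<open>a\<close> only in the second factor, through \<open>y - x\<close>.\<close>
    have "(\<Sum>z\<in>UNIV. s (z - dot_prod a x) x * cnj (s (z - dot_prod a y) y))
        = (\<Sum>z\<in>UNIV. s z x * cnj (s (z - dot_prod a (y - x)) y))" for a
    proof -
      have "dot_prod a (y - x) = dot_prod a y - dot_prod a x"
        by (simp add: dot_prod_def right_diff_distrib sum_subtractf)
      then show ?thesis
        by (intro sum.reindex_bij_witness[where i = "\<lambda>z. z + dot_prod a x"
              and j = "\<lambda>z. z - dot_prod a x"]) (auto simp: algebra_simps)
    qed
    then have "(\<Sum>a\<in>UNIV. \<Sum>z\<in>UNIV. s (z - dot_prod a x) x * cnj (s (z - dot_prod a y) y))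
        = (\<Sum>a\<in>UNIV. \<Sum>z\<in>UNIV. s z x * cnj (s (z - dot_prod a (y - x)) y))"
      by simp
    also have "\<dots> = (\<Sum>z\<in>UNIV. s z x * (\<Sum>a\<in>UNIV. cnj (s (z - dot_prod a (y - x)) y)))"
      by (subst sum.swap) (simp add: sum_distrib_left)
    also have "\<dots> = (if x = y then of_nat (CARD('f) ^ CARD('t)) * (\<Sum>z\<in>UNIV. s z x * cnj (s z x)) else 0)"
    proof (cases "x = y")
      case True
      then show ?thesis
        by (simp add: dot_prod_def sum_distrib_left mult_ac)
    next
      case False
      have "(\<Sum>a\<in>UNIV. cnj (s (z - dot_prod a (y - x)) y)) = 0" for z
      proof (rule sum_dot_prod_eq_0)
        have "(\<Sum>u\<in>UNIV. cnj (s (z - u) y)) = (\<Sum>u\<in>UNIV. cnj (s u y))"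
          by (rule sum.reindex_bij_witness[where i = "\<lambda>u. z - u" and j = "\<lambda>u. z - u"]) auto
        then show "(\<Sum>u\<in>UNIV. cnj (s (z - u) y)) = 0"
          by (simp add: s flip: cnj_sum)
      qed (use False in simp)
      then show ?thesis
        using False by simp
    qed
    finally show ?thesis .
  qed
  \<comment> \<open>Over the complex numbers the squared modulus is a product with the conjugate;
    the exchanges of sums then move \<open>x\<close> and \<open>y\<close> outward so that
    \<open>cross\<close> applies.\<close>
  have "complex_of_real (\<Sum>a\<in>UNIV. \<Sum>z\<in>UNIV. (cmod (\<Sum>x\<in>UNIV. s (z - dot_prod a x) x))\<^sup>2)
      = (\<Sum>a\<in>UNIV. \<Sum>z\<in>UNIV. \<Sum>x\<in>UNIV. \<Sum>y\<in>UNIV.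
          s (z - dot_prod a x) x * cnj (s (z - dot_prod a y) y))"
    unfolding of_real_sum complex_norm_square cnj_sum sum_product ..
  also have "\<dots> = (\<Sum>a\<in>UNIV. \<Sum>x\<in>UNIV. \<Sum>z\<in>UNIV. \<Sum>y\<in>UNIV.
          s (z - dot_prod a x) x * cnj (s (z - dot_prod a y) y))"
    by (intro sum.cong refl sum.swap)
  also have "\<dots> = (\<Sum>x\<in>UNIV. \<Sum>a\<in>UNIV. \<Sum>y\<in>UNIV. \<Sum>z\<in>UNIV.
          s (z - dot_prod a x) x * cnj (s (z - dot_prod a y) y))"
    by (subst sum.swap) (intro sum.cong refl sum.swap)
  also have "\<dots> = (\<Sum>x\<in>UNIV. \<Sum>y\<in>UNIV. \<Sum>a\<in>UNIV. \<Sum>z\<in>UNIV.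
          s (z - dot_prod a x) x * cnj (s (z - dot_prod a y) y))"
    by (intro sum.cong refl sum.swap)
  also have "\<dots> = (\<Sum>x\<in>UNIV. of_nat (CARD('f) ^ CARD('t)) * (\<Sum>z\<in>UNIV. s z x * cnj (s z x)))"
    by (simp add: cross)
  also have "\<dots> = of_nat (CARD('f) ^ CARD('t)) * (\<Sum>z\<in>UNIV. \<Sum>x\<in>UNIV. s z x * cnj (s z x))"
    by (subst sum.swap) (simp flip: sum_distrib_left)
  also have "\<dots> = of_real (real CARD('f) ^ CARD('t) * (\<Sum>x0\<in>UNIV. \<Sum>x\<in>UNIV. (cmod (s x0 x))\<^sup>2))"
    unfolding of_real_mult of_real_sum complex_norm_square by simp
  finally show ?thesis
    by (simp only: of_real_eq_iff)
qed

text \<open>The weights do not depend on \<open>a\<close> or \<open>z\<close>, so the scalar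
  identity applies to each matrix entry separately.\<close>

lemma sum_weighted_hs_linear_form_fibres:
  fixes \<sigma> :: "'f::{field,finite} \<Rightarrow> 'f^'t::finite \<Rightarrow> complex^'e^'e"
  assumes \<sigma>: "\<And>x. (\<Sum>x0\<in>UNIV. \<sigma> x0 x) = 0"
  shows "(\<Sum>a\<in>UNIV. \<Sum>z\<in>UNIV. weighted_hs m (\<Sum>x\<in>UNIV. \<sigma> (z - dot_prod a x) x))
    = real CARD('f) ^ CARD('t) * (\<Sum>x0\<in>UNIV. \<Sum>x\<in>UNIV. weighted_hs m (\<sigma> x0 x))"
proof -
  have pull: "(\<Sum>a\<in>X. \<Sum>z\<in>Y. weighted_hs m (F a z))
      = (\<Sum>i\<in>UNIV. \<Sum>j\<in>UNIV. (\<Sum>a\<in>X. \<Sum>z\<in>Y. (cmod (F a z $ i $ j))\<^sup>2) / sqrt (m i * m j))"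
    for X :: "'x set" and Y :: "'y set" and F :: "'x \<Rightarrow> 'y \<Rightarrow> complex^'e^'e"
  proof -
    have "(\<Sum>a\<in>X. \<Sum>z\<in>Y. weighted_hs m (F a z))
        = (\<Sum>(a, z)\<in>X \<times> Y. \<Sum>(i, j)\<in>UNIV. (cmod (F a z $ i $ j))\<^sup>2 / sqrt (m i * m j))"
      by (simp add: weighted_hs_def sum_UNIV_prod sum.cartesian_product[where A = X and B = Y])
    also have "\<dots> = (\<Sum>(i, j)\<in>UNIV. \<Sum>(a, z)\<in>X \<times> Y. (cmod (F a z $ i $ j))\<^sup>2 / sqrt (m i * m j))"
      unfolding case_prod_beta by (rule sum.swap)
    also have "\<dots> = (\<Sum>i\<in>UNIV. \<Sum>j\<in>UNIV. (\<Sum>a\<in>X. \<Sum>z\<in>Y. (cmod (F a z $ i $ j))\<^sup>2) / sqrt (m i * m j))"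
      by (simp add: sum_UNIV_prod sum_divide_distrib sum.cartesian_product[where A = X and B = Y]
          case_prod_beta)
    finally show ?thesis .
  qed
  have "(\<Sum>x0\<in>UNIV. \<sigma> x0 x $ i $ j) = 0" for x i j
    using arg_cong[OF \<sigma>[of x], of "\<lambda>A. A $ i $ j"] by simp
  then have entry: "(\<Sum>a\<in>UNIV. \<Sum>z\<in>UNIV. (cmod ((\<Sum>x\<in>UNIV. \<sigma> (z - dot_prod a x) x) $ i $ j))\<^sup>2)
      = real CARD('f) ^ CARD('t) * (\<Sum>x0\<in>UNIV. \<Sum>x\<in>UNIV. (cmod (\<sigma> x0 x $ i $ j))\<^sup>2)" for i j
    using sum_norm_square_linear_form_fibres[of "\<lambda>x0 x. \<sigma> x0 x $ i $ j"] by simp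
  show ?thesis
    unfolding pull entry by (simp only: sum_distrib_left times_divide_eq_right)
qed

section \<open>The extractor bound\<close>

text \<open>At a fixed \<open>v\<close>, the form of \<open>Y z\<close> lies between 0 and that of
  the total, because the remaining blocks sum to a positive operator. The total divided by
  \<open>CARD('f)\<close> lies in the same interval, so the two differ by at most its
  length.\<close>

lemma deviation_from_mean_bound:
  fixes Y :: "'f::finite \<Rightarrow> complex^'e::finite^'e"
  assumes Y: "\<And>z. pos_semidef (Y z)" and sum_Y: "(\<Sum>z\<in>UNIV. Y z) = diag_mat l"
  shows "cmod (cdot v ((Y z - (1 / real CARD('f)) *\<^sub>R diag_mat l) *v v))
    \<le> (\<Sum>i\<in>UNIV. l i * (cmod (v $ i))\<^sup>2)"
proof -
  define q where "q = (\<Sum>i\<in>UNIV. l i * (cmod (v $ i))\<^sup>2)"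
  obtain y where y: "0 \<le> y" "cdot v (Y z *v v) = of_real y"
    using cdot_pos_semidef[OF Y] .
  obtain y' where y': "0 \<le> y'" "cdot v ((\<Sum>w\<in>UNIV - {z}. Y w) *v v) = of_real y'"
    using cdot_pos_semidef[OF pos_semidef_sum[of "UNIV - {z}" Y]] Y by blast
  have q: "cdot v (diag_mat l *v v) = of_real q"
    by (simp only: cdot_diag_mat q_def)
  have "of_real q = cdot v ((Y z + (\<Sum>w\<in>UNIV - {z}. Y w)) *v v)"
    by (simp add: sum_Y q flip: sum.remove)
  then have yq: "q = y + y'"
    by (simp add: matrix_vector_mult_add_rdistrib cdot_simps y y' flip: of_real_add)
  have "1 \<le> real CARD('f)"
    using Suc_leI[OF zero_less_card_finite[where 'a = 'f]] by simp
  then have "0 \<le> q / real CARD('f)" "q / real CARD('f) \<le> q"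
    using yq y(1) y'(1) mult_left_mono[of 1 "real CARD('f)" q] by (auto simp: divide_le_eq)
  then have "\<bar>y - q / real CARD('f)\<bar> \<le> q"
    using yq y(1) y'(1) by linarith
  moreover have "cdot v ((Y z - (1 / real CARD('f)) *\<^sub>R diag_mat l) *v v)
      = of_real (y - q / real CARD('f))"
    by (simp add: matrix_vector_mult_diff_rdistrib cdot_simps cdot_scaleR_mult y q)
  ultimately show ?thesis
    unfolding q_def by (simp only: norm_of_real)
qed

text \<open>Replacing the weights \<open>l\<close> by \<open>l + \<delta>\<close> makes the weighting invertible; then \<open>\<delta> \<rightarrow> 0\<close>.\<close>

lemma extractor_bound_diag:
  fixes E :: "'f::{field,finite} \<Rightarrow> 'f^'t::finite \<Rightarrow> complex^'e::finite^'e"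
  assumes E: "\<And>x0 x. pos_semidef (E x0 x)"
    and sum_E: "(\<Sum>x0\<in>UNIV. \<Sum>x\<in>UNIV. E x0 x) = diag_mat l"
    and l: "\<And>i. 0 \<le> l i" "(\<Sum>i\<in>UNIV. l i) = 1"
    and c: "\<And>a. trace_norm (blockdiag (\<lambda>z.
      (\<Sum>x\<in>UNIV. E (z - dot_prod a x) x) - (1 / real CARD('f)) *\<^sub>R diag_mat l)) \<le> c"
  shows "(trace_norm (blockdiag (\<lambda>x0. blockdiag (\<lambda>x.
      E x0 x - (1 / real CARD('f)) *\<^sub>R (\<Sum>y\<in>UNIV. E y x)))))\<^sup>2 \<le> real CARD('f) ^ (CARD('t) + 1) * c"
proof -
  define p where "p = real CARD('f)"
  define \<sigma> where "\<sigma> x0 x = E x0 x - (1 / p) *\<^sub>R (\<Sum>y\<in>UNIV. E y x)" for x0 x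
  define D where "D a z = (\<Sum>x\<in>UNIV. E (z - dot_prod a x) x) - (1 / p) *\<^sub>R diag_mat l"
    for a :: "'f^'t" and z
  define A where "A = blockdiag (\<lambda>x0. blockdiag (\<sigma> x0))"
  have p: "0 < p"
    by (simp add: p_def)
  have herm_E: "conj_transpose (E x0 x) = E x0 x" for x0 x
    using E by (simp add: pos_semidef_cdot)
  have herm_\<sigma>: "conj_transpose (\<sigma> x0 x) = \<sigma> x0 x" for x0 x
    by (simp add: \<sigma>_def conj_transpose_diff conj_transpose_scaleR conj_transpose_sum herm_E)
  have herm_D: "conj_transpose (D a z) = D a z" for a z
    by (simp add: D_def conj_transpose_diff conj_transpose_scaleR conj_transpose_sum herm_E)
  have herm_A: "conj_transpose A = A"
    by (simp add: A_def conj_transpose_blockdiag herm_\<sigma>)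
  have sum_\<sigma>: "(\<Sum>x0\<in>UNIV. \<sigma> x0 x) = 0" for x
    by (simp add: \<sigma>_def sum_subtractf p_def sum_constant_scaleR del: sum_constant)
  \<comment> \<open>Along each fibre the subtracted means add up to the diagonal total divided by
    \<open>p\<close>, so the deviation for \<open>a\<close> is a sum of blocks
    \<open>\<sigma>\<close> with vanishing marginals, as the averaging identity requires.\<close>
  have D_\<sigma>: "D a z = (\<Sum>x\<in>UNIV. \<sigma> (z - dot_prod a x) x)" for a z
    using sum_E sum.swap[of "\<lambda>x0 x. E x0 x" UNIV UNIV]
    by (simp add: D_def \<sigma>_def sum_subtractf flip: scaleR_sum_right)
  have sum_Y: "(\<Sum>z\<in>UNIV. \<Sum>x\<in>UNIV. E (z - dot_prod a x) x) = diag_mat l" for a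
  proof -
    have "(\<Sum>z\<in>UNIV. E (z - dot_prod a x) x) = (\<Sum>z\<in>UNIV. E z x)" for x
      by (rule sum.reindex_bij_witness[where i = "\<lambda>z. z + dot_prod a x"
            and j = "\<lambda>z. z - dot_prod a x"]) auto
    then show ?thesis
      using sum_E sum.swap[of "\<lambda>x0 x. E x0 x" UNIV UNIV]
        sum.swap[of "\<lambda>z x. E (z - dot_prod a x) x" UNIV UNIV] by simp
  qed
  have perturbed: "(trace_norm A)\<^sup>2 \<le> (1 + real CARD('e) * \<delta>) * (p ^ (CARD('t) + 1) * c)"
    if \<delta>: "0 < \<delta>" for \<delta>
  proof -
    define m where "m i = l i + \<delta>" for i
    have m: "0 < m i" for i
      using l(1) \<delta> by (simp add: m_def add_nonneg_pos)
    have hs_D: "weighted_hs (\<lambda>i. m (snd i)) (blockdiag (D a)) \<le> c" for a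
    proof -
      have "cmod (cdot v (blockdiag (D a) *v v)) \<le> (\<Sum>i\<in>UNIV. m (snd i) * (cmod (v $ i))\<^sup>2)" for v
      proof -
        have "cmod (cdot v (blockdiag (D a) *v v))
            \<le> (\<Sum>z\<in>UNIV. cmod (cdot (\<chi> i. v $ (z, i)) (D a z *v (\<chi> i. v $ (z, i)))))"
          unfolding cdot_blockdiag by (rule norm_sum)
        also have "\<dots> \<le> (\<Sum>z\<in>UNIV. \<Sum>i\<in>UNIV. l i * (cmod ((\<chi> i. v $ (z, i)) $ i))\<^sup>2)"
          unfolding D_def p_def
          by (intro sum_mono deviation_from_mean_bound pos_semidef_sum E sum_Y)
        also have "\<dots> \<le> (\<Sum>z\<in>UNIV. \<Sum>i\<in>UNIV. m i * (cmod (v $ (z, i)))\<^sup>2)"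
          using \<delta> by (intro sum_mono) (simp add: m_def mult_right_mono)
        also have "\<dots> = (\<Sum>i\<in>UNIV. m (snd i) * (cmod (v $ i))\<^sup>2)"
          by (simp add: sum_UNIV_prod)
        finally show ?thesis .
      qed
      then have "weighted_hs (\<lambda>i. m (snd i)) (blockdiag (D a)) \<le> trace_norm (blockdiag (D a))"
        using m by (intro weighted_hs_le_trace_norm) (simp_all add: conj_transpose_blockdiag herm_D)
      also have "\<dots> \<le> c"
        using c[of a] by (simp add: D_def[abs_def] p_def)
      finally show ?thesis .
    qed
    \<comment> \<open>Each of the \<open>p ^ CARD('t)\<close> linear forms contributes at most
      \<open>c\<close>, and their number cancels the factor from the averaging identity.\<close>
    have "p ^ CARD('t) * (\<Sum>x0\<in>UNIV. \<Sum>x\<in>UNIV. weighted_hs m (\<sigma> x0 x))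
        = (\<Sum>a\<in>UNIV. \<Sum>z\<in>UNIV. weighted_hs m (D a z))"
      unfolding D_\<sigma> p_def sum_weighted_hs_linear_form_fibres[OF sum_\<sigma>] ..
    also have "\<dots> = (\<Sum>a\<in>UNIV. weighted_hs (\<lambda>i. m (snd i)) (blockdiag (D a)))"
      by (simp add: weighted_hs_blockdiag)
    also have "\<dots> \<le> (\<Sum>a\<in>(UNIV :: ('f^'t) set). c)"
      by (intro sum_mono hs_D)
    also have "\<dots> = p ^ CARD('t) * c"
      by (simp add: p_def)
    finally have "(\<Sum>x0\<in>UNIV. \<Sum>x\<in>UNIV. weighted_hs m (\<sigma> x0 x)) \<le> c"
      using p by simp
    moreover have "weighted_hs (\<lambda>i. m (snd (snd i))) A = (\<Sum>x0\<in>UNIV. \<Sum>x\<in>UNIV. weighted_hs m (\<sigma> x0 x))"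
      unfolding A_def
      by (simp add: weighted_hs_blockdiag[of "\<lambda>i. m (snd i)"] weighted_hs_blockdiag)
    ultimately have hs_A: "weighted_hs (\<lambda>i. m (snd (snd i))) A \<le> c"
      by simp
    \<comment> \<open>The weights ignore the classical registers, whose joint dimension gives the
      power of \<open>p\<close>; the total weight on the quantum register is the unit trace plus the
      perturbation.\<close>
    have sum_m: "(\<Sum>i\<in>(UNIV :: ('f \<times> ('f^'t) \<times> 'e) set). m (snd (snd i)))
        = p ^ (CARD('t) + 1) * (1 + real CARD('e) * \<delta>)"
      by (simp add: sum_UNIV_prod m_def sum.distrib l(2) p_def) (simp add: algebra_simps)
    have "(trace_norm A)\<^sup>2
        \<le> (\<Sum>i\<in>(UNIV :: ('f \<times> ('f^'t) \<times> 'e) set). m (snd (snd i))) * weighted_hs (\<lambda>i. m (snd (snd i))) A"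
      by (rule trace_norm_square_le_weighted_hs[OF herm_A]) (rule m)
    also have "\<dots> \<le> (p ^ (CARD('t) + 1) * (1 + real CARD('e) * \<delta>)) * c"
      unfolding sum_m using hs_A p \<delta> by (intro mult_left_mono) auto
    finally show ?thesis
      by (simp add: mult_ac)
  qed
  have "((\<lambda>\<delta>. (1 + real CARD('e) * \<delta>) * (p ^ (CARD('t) + 1) * c))
      \<longlongrightarrow> (1 + real CARD('e) * 0) * (p ^ (CARD('t) + 1) * c)) (at_right 0)"
    by (intro tendsto_intros)
  moreover have "\<forall>\<^sub>F \<delta> in at_right 0. (trace_norm A)\<^sup>2 \<le> (1 + real CARD('e) * \<delta>) * (p ^ (CARD('t) + 1) * c)"
    using perturbed by (auto simp: eventually_at_right_less intro: eventually_mono[OF eventually_at_right_less])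
  ultimately have "(trace_norm A)\<^sup>2 \<le> (1 + real CARD('e) * 0) * (p ^ (CARD('t) + 1) * c)"
    by (intro tendsto_lowerbound) auto
  then show ?thesis
    by (simp add: A_def \<sigma>_def[abs_def] p_def)
qed

text \<open>Reduction to the diagonal case: rotating the quantum register into an eigenbasis of the
  total \<open>R\<close> acts linearly on the blocks and preserves positivity, trace and both trace
  norms.\<close>

lemma extractor_bound_blocks:
  fixes \<rho>E :: "'f::{field,finite} \<Rightarrow> 'f^'t::finite \<Rightarrow> complex^'e::finite^'e"
  assumes psd: "\<And>x0 x. pos_semidef (\<rho>E x0 x)"
    and tr: "trace (\<Sum>x0\<in>UNIV. \<Sum>x\<in>UNIV. \<rho>E x0 x) = 1"
    and c: "\<And>a. trace_norm (blockdiag (\<lambda>z. (\<Sum>x\<in>UNIV. \<rho>E (z - dot_prod a x) x)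
      - (1 / real CARD('f)) *\<^sub>R (\<Sum>x0\<in>UNIV. \<Sum>x\<in>UNIV. \<rho>E x0 x))) \<le> c"
  shows "(trace_norm (blockdiag (\<lambda>x0. blockdiag (\<lambda>x.
      \<rho>E x0 x - (1 / real CARD('f)) *\<^sub>R (\<Sum>y\<in>UNIV. \<rho>E y x)))))\<^sup>2 \<le> real CARD('f) ^ (CARD('t) + 1) * c"
proof -
  define R where "R = (\<Sum>x0\<in>UNIV. \<Sum>x\<in>UNIV. \<rho>E x0 x)"
  have R: "pos_semidef R"
    unfolding R_def by (intro pos_semidef_sum psd)
  obtain U l where U: "unitary U" and Ul: "R = U ** diag_mat l ** conj_transpose U"
    using spectral_theorem_hermitian[of R] R by (auto simp: pos_semidef_cdot)
  define C where "C A = conj_transpose U ** A ** U" for A :: "complex^'e^'e"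
  have C: "linear C"
    using linear_conjugate[of "conj_transpose U" U] by (simp add: C_def[abs_def])
  have CR: "C R = diag_mat l"
  proof -
    have "C R = (conj_transpose U ** U) ** diag_mat l ** (conj_transpose U ** U)"
      by (simp only: C_def Ul matrix_mul_assoc)
    then show ?thesis
      by (simp add: unitaryD[OF U])
  qed
  have trace_norm_C: "trace_norm (blockdiag (\<lambda>k. C (F k))) = trace_norm (blockdiag F)"
    if "\<And>k. conj_transpose (F k) = F k" for F :: "'k::finite \<Rightarrow> complex^'e^'e"
    using trace_norm_blockdiag_conjugate[OF that unitary_conj_transpose[OF U]] by (simp add: C_def)
  have trace_norm_C': "trace_norm (blockdiag (\<lambda>x0. blockdiag (\<lambda>x. C (F x0 x))))
      = trace_norm (blockdiag (\<lambda>x0. blockdiag (F x0)))"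
    if "\<And>x0 x. conj_transpose (F x0 x) = F x0 x" for F :: "'f \<Rightarrow> 'f^'t \<Rightarrow> complex^'e^'e"
    using trace_norm_blockdiag_conjugate[of "\<lambda>x0. blockdiag (F x0)",
        OF _ unitary_blockdiag[OF unitary_conj_transpose[OF U]]] that
    by (simp add: C_def conj_transpose_blockdiag blockdiag_mult)
  have herm: "conj_transpose (\<rho>E x0 x) = \<rho>E x0 x" for x0 x
    using psd by (simp add: pos_semidef_cdot)
  have "(trace_norm (blockdiag (\<lambda>x0. blockdiag (\<lambda>x.
      C (\<rho>E x0 x) - (1 / real CARD('f)) *\<^sub>R (\<Sum>y\<in>UNIV. C (\<rho>E y x))))))\<^sup>2
      \<le> real CARD('f) ^ (CARD('t) + 1) * c"
  proof (rule extractor_bound_diag)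
    show "pos_semidef (C (\<rho>E x0 x))" for x0 x
      using pos_semidef_conjugate[OF psd, of "conj_transpose U"] by (simp add: C_def)
    show "(\<Sum>x0\<in>UNIV. \<Sum>x\<in>UNIV. C (\<rho>E x0 x)) = diag_mat l"
      by (simp add: R_def flip: CR linear_sum[OF C])
    show "0 \<le> l i" for i
    proof -
      have "of_real (l i) = cdot (column i U) (R *v column i U)"
        using conj_mult_nth[of U R U i i] CR by (simp add: C_def) (simp add: diag_mat_def)
      moreover have "0 \<le> Re (cdot (column i U) (R *v column i U))"
        using R by (simp add: pos_semidef_cdot)
      ultimately show ?thesis
        by (metis Re_complex_of_real)
    qed
    have "of_real (\<Sum>i\<in>UNIV. l i) = trace (C R)"
      by (simp only: CR trace_diag_mat)
    also have "\<dots> = 1"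
      using tr by (simp add: C_def trace_conjugate[OF U] R_def)
    finally show "(\<Sum>i\<in>UNIV. l i) = 1"
      by (simp only: of_real_eq_1_iff)
    show "trace_norm (blockdiag (\<lambda>z. (\<Sum>x\<in>UNIV. C (\<rho>E (z - dot_prod a x) x))
        - (1 / real CARD('f)) *\<^sub>R diag_mat l)) \<le> c" for a
    proof -
      have "trace_norm (blockdiag (\<lambda>z. C ((\<Sum>x\<in>UNIV. \<rho>E (z - dot_prod a x) x)
          - (1 / real CARD('f)) *\<^sub>R R))) \<le> c"
        using c[of a] R
        by (subst trace_norm_C) (simp_all add: R_def[symmetric] conj_transpose_diff
            conj_transpose_scaleR conj_transpose_sum herm pos_semidef_cdot)
      then show ?thesis
        by (simp add: linear_diff[OF C] linear_scale[OF C] linear_sum[OF C] CR)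
    qed
  qed
  also have "trace_norm (blockdiag (\<lambda>x0. blockdiag (\<lambda>x.
      C (\<rho>E x0 x) - (1 / real CARD('f)) *\<^sub>R (\<Sum>y\<in>UNIV. C (\<rho>E y x)))))
      = trace_norm (blockdiag (\<lambda>x0. blockdiag (\<lambda>x.
          \<rho>E x0 x - (1 / real CARD('f)) *\<^sub>R (\<Sum>y\<in>UNIV. \<rho>E y x))))"
    by (subst trace_norm_C'[symmetric])
      (simp_all add: linear_diff[OF C] linear_scale[OF C] linear_sum[OF C]
        conj_transpose_diff conj_transpose_scaleR conj_transpose_sum herm)
  finally show ?thesis .
qed

text \<open>For fixed \<open>a\<close> and \<open>z\<close>, the value of \<open>x\<close>
  determines \<open>x0\<close>, so the fibre is parametrised by \<open>x\<close> alone.\<close>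

lemma state_ZE_eq_blockdiag:
  "state_ZE \<rho>E a = blockdiag (\<lambda>z. \<Sum>x\<in>UNIV. \<rho>E (z - dot_prod a x) x)"
proof -
  have "(\<Sum>(x0, x)\<in>{(x0, x). x0 + dot_prod a x = z}. \<rho>E x0 x)
      = (\<Sum>x\<in>UNIV. \<rho>E (z - dot_prod a x) x)" for z
    by (rule sum.reindex_bij_witness[where i = "\<lambda>x. (z - dot_prod a x, x)" and j = snd])
      (auto simp: algebra_simps)
  then show ?thesis
    by (simp add: state_ZE_def sum_kron_basis_proj)
qed

theorem lemma2:
  fixes \<rho> :: "complex^('f \<times> ('f^'t) \<times> 'e)^('f::{field,finite} \<times> ('f^'t::finite) \<times> 'e::finite)"
    and \<rho>E :: "'f \<Rightarrow> 'f^'t \<Rightarrow> complex^'e^'e"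
    and \<epsilon> :: real
  assumes "ccq_state \<rho> \<rho>E"
    and "\<epsilon> \<ge> 0"
    and "\<And>a :: 'f^'t.
      1 / 2 * trace_norm (state_ZE \<rho>E a - kron max_mixed (ptrace_fst (ptrace_fst \<rho>))) \<le> \<epsilon>"
  shows "1 / 2 * trace_norm (\<rho> - kron max_mixed (ptrace_fst \<rho>))
    \<le> real CARD('f) powr ((real CARD('t) + 1) / 2) * sqrt (\<epsilon> / 2)"
proof -
  have \<rho>: "\<rho> = blockdiag (\<lambda>x0. blockdiag (\<rho>E x0))"
    and psd: "\<And>x0 x. pos_semidef (\<rho>E x0 x)" and tr: "trace \<rho> = 1"
  proof -
    have "\<rho> = (\<Sum>x0\<in>UNIV. \<Sum>x\<in>UNIV. kron (basis_proj x0) (kron (basis_proj x) (\<rho>E x0 x)))"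
      using assms(1) by (simp add: ccq_state_def)
    also have "\<dots> = blockdiag (\<lambda>x0. blockdiag (\<rho>E x0))"
      by (simp add: sum_kron_basis_proj flip: kron_sum_right)
    finally show "\<rho> = blockdiag (\<lambda>x0. blockdiag (\<rho>E x0))" .
  qed (use assms(1) in \<open>auto simp: ccq_state_def\<close>)
  have ptr: "ptrace_fst \<rho> = blockdiag (\<lambda>x. \<Sum>x0\<in>UNIV. \<rho>E x0 x)"
    by (simp add: \<rho> ptrace_fst_blockdiag blockdiag_sum)
  have ptr2: "ptrace_fst (ptrace_fst \<rho>) = (\<Sum>x0\<in>UNIV. \<Sum>x\<in>UNIV. \<rho>E x0 x)"
    by (simp add: ptr ptrace_fst_blockdiag) (rule sum.swap)
  \<comment> \<open>The block bound applies with \<open>c = 2 * \<epsilon>\<close>, because the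
    hypothesis bounds half the trace norm. The partial trace is rewritten before
    \<open>\<rho>\<close>, whose expansion would hide it.\<close>
  have "(trace_norm (\<rho> - kron max_mixed (ptrace_fst \<rho>)))\<^sup>2 \<le> real CARD('f) ^ (CARD('t) + 1) * (2 * \<epsilon>)"
    unfolding ptr unfolding \<rho> kron_max_mixed blockdiag_scaleR blockdiag_diff
  proof (rule extractor_bound_blocks[OF psd])
    show "trace (\<Sum>x0\<in>UNIV. \<Sum>x\<in>UNIV. \<rho>E x0 x) = 1"
      using tr by (simp add: \<rho> trace_blockdiag trace_sum)
    show "trace_norm (blockdiag (\<lambda>z. (\<Sum>x\<in>UNIV. \<rho>E (z - dot_prod a x) x)
      - (1 / real CARD('f)) *\<^sub>R (\<Sum>x0\<in>UNIV. \<Sum>x\<in>UNIV. \<rho>E x0 x))) \<le> 2 * \<epsilon>" for a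
      using assms(3)[of a]
      by (simp add: state_ZE_eq_blockdiag ptr2 kron_max_mixed blockdiag_diff)
  qed
  then have "trace_norm (\<rho> - kron max_mixed (ptrace_fst \<rho>))
      \<le> sqrt (real CARD('f) ^ (CARD('t) + 1) * (2 * \<epsilon>))"
    by (rule real_le_rsqrt)
  \<comment> \<open>Writing \<open>2 * \<epsilon>\<close> as \<open>4 * (\<epsilon> / 2)\<close>
    releases the factor 2 that cancels the \<open>1 / 2\<close> in the conclusion.\<close>
  also have "\<dots> = 2 * (sqrt (real CARD('f) ^ (CARD('t) + 1)) * sqrt (\<epsilon> / 2))"
    by (simp add: real_sqrt_mult real_sqrt_divide field_simps)
  also have "sqrt (real CARD('f) ^ (CARD('t) + 1)) = real CARD('f) powr ((real CARD('t) + 1) / 2)"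
  proof -
    have "real CARD('f) ^ (CARD('t) + 1) = real CARD('f) powr (real CARD('t) + 1)"
      using powr_realpow[of "real CARD('f)" "CARD('t) + 1"] by (simp add: add.commute)
    then have "sqrt (real CARD('f) ^ (CARD('t) + 1)) = (real CARD('f) powr (real CARD('t) + 1)) powr (1 / 2)"
      by (simp only: powr_half_sqrt powr_ge_zero)
    then show ?thesis
      by (simp only: powr_powr times_divide_eq_right mult_1_right)
  qed
  finally show ?thesis
    by simp
qed

end
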